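(* Let $$G:=\Big\{\begin{pmatrix}0&1\\1&0\end{pmatrix}\Big\}\cup\operatorname{conv}\Big\{\begin{pmatrix}1&0\\0&1\end{pmatrix},\begin{pmatrix}1&1\\0&0\end{pmatrix}\Big\}\subseteq s(2).$$ Then the semigroup generated by $G$ equals $s(2)$, and $N_G(s(2))=4$; that is, $G^4=s(2)$ while $G^3\subsetneq s(2)$.
   Context: $s(2)$ is the set of $2\times2$ real matrices with non-negative entries whose columns each sum to $1$, a monoid under matrix multiplication. $\operatorname{conv}$ denotes convex hull. For a subset $G$, the semigroup generated by $G$ is the set of all finite products $g_1\cdots g_m$, $m\ge1$, $g_j\in G$; $G^k$ is the set of products of exactly $k$ elements of $G$. For $x$ in the generated semigroup, $N_G(x)$ is the least $m$ such that $x$ is a product of $m$ elements of $G$, and $N_G(S)=\sup_{x\in S}N_G(x)$. *)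

theory Defs
  imports "HOL-Analysis.Analysis" "HOL-Library.Extended_Nat"
begin

text \<open>2x2 real matrices are \<open>real^2^2\<close>; \<open>A $ i $ j\<close> is the entry in row i, column j;
  \<open>vector [vector [a,b], vector [c,d]]\<close> has rows (a,b) and (c,d).\<close>

definition s2 :: "(real^2^2) set" where
  "s2 = {A. (\<forall>i j. 0 \<le> A $ i $ j) \<and> (\<forall>j. (\<Sum>i\<in>UNIV. A $ i $ j) = 1)}"

text \<open>Products of exactly k elements of G.\<close>
definition gpow :: "(real^2^2) set \<Rightarrow> nat \<Rightarrow> (real^2^2) set" where
  "gpow G k = {foldr (**) xs (mat 1) | xs. length xs = k \<and> set xs \<subseteq> G}"

text \<open>Semigroup generated by G: all finite products of length at least 1.\<close>
definition gen_semigroup :: "(real^2^2) set \<Rightarrow> (real^2^2) set" where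
  "gen_semigroup G = (\<Union>k\<in>{1..}. gpow G k)"

definition NG :: "(real^2^2) set \<Rightarrow> real^2^2 \<Rightarrow> nat" where
  "NG G x = (LEAST m. 1 \<le> m \<and> x \<in> gpow G m)"

definition NG_set :: "(real^2^2) set \<Rightarrow> (real^2^2) set \<Rightarrow> enat" where
  "NG_set G S = (SUP x\<in>S. enat (NG G x))"

end

theory Submission imports Defs begin

text \<open>A matrix of \<open>s(2)\<close> is determined by its first row \<open>(a, b)\<close>; write it \<open>stoch2 a b\<close>.
  Right multiplication by the swap \<open>stoch2 0 1\<close> exchanges \<open>a\<close> and \<open>b\<close>, and right
  multiplication by \<open>stoch2 1 t\<close> keeps \<open>a\<close> and moves \<open>b\<close> to the point \<open>b + t (a - b)\<close> of the
  segment from \<open>b\<close> to \<open>a\<close>. Every product over \<open>G\<close> starts with first row \<open>(1, t)\<close> or \<open>(0, 1)\<close>.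
  Hence \<open>(a, b)\<close> with \<open>a < b\<close> is reached as \<open>(1, a) \<mapsto> (a, 1) \<mapsto> (a, b)\<close> and \<open>(a, b)\<close> with
  \<open>b \<le> a\<close> as \<open>(1, b) \<mapsto> (b, 1) \<mapsto> (b, a) \<mapsto> (a, b)\<close>, so four factors suffice.
  Conversely, a row with \<open>0 < b < a < 1\<close> such as \<open>(3/4, 1/4)\<close> needs a swap to move the first
  entry off \<open>{0, 1}\<close>; right after it the second entry is \<open>1\<close>, segment moves keep it above the
  first, so a second swap is needed as well: four factors in all.\<close>

lemma foldr_in_gpow: "set xs \<subseteq> G \<Longrightarrow> foldr (**) xs (mat 1) \<in> gpow G (length xs)"
  unfolding gpow_def by blast

lemma gpow_subset_monoid:
  assumes "G \<subseteq> S" "mat 1 \<in> S" "\<And>A B. A \<in> S \<Longrightarrow> B \<in> S \<Longrightarrow> A ** B \<in> S"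
  shows "gpow G k \<subseteq> S"
proof -
  have "set xs \<subseteq> G \<Longrightarrow> foldr (**) xs (mat 1) \<in> S" for xs
    by (induction xs) (use assms in auto)
  then show ?thesis
    unfolding gpow_def by blast
qed

lemma gpow_mono:
  assumes "mat 1 \<in> G" "m \<le> n"
  shows "gpow G m \<subseteq> gpow G n"
  using assms(2)
proof (induction n rule: dec_induct)
  case (step n)
  have "gpow G n \<subseteq> gpow G (Suc n)"
  proof
    fix x assume "x \<in> gpow G n"
    then obtain xs where "length xs = n" "set xs \<subseteq> G" "x = foldr (**) xs (mat 1)"
      unfolding gpow_def by blast
    then show "x \<in> gpow G (Suc n)"
      using foldr_in_gpow[of "mat 1 # xs" G] assms(1) by simp
  qed
  with step.IH show ?case by blast
qed simp

lemma gen_semigroup_eqI: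
  assumes "\<And>k. gpow G k \<subseteq> S" "gpow G n = S" "1 \<le> n"
  shows "gen_semigroup G = S"
  unfolding gen_semigroup_def using assms by force

lemma NG_le: "1 \<le> k \<Longrightarrow> x \<in> gpow G k \<Longrightarrow> NG G x \<le> k"
  unfolding NG_def by (rule Least_le) simp

lemma NG_eq_Suc:
  assumes "mat 1 \<in> G" "x \<in> gpow G (Suc n)" "x \<notin> gpow G n"
  shows "NG G x = Suc n"
proof -
  have "Suc n \<le> NG G x"
    unfolding NG_def
  proof (rule LeastI2[of _ "Suc n"])
    fix m assume "1 \<le> m \<and> x \<in> gpow G m"
    then show "Suc n \<le> m"
      using gpow_mono[OF assms(1), of m n] assms(3) by (cases "m \<le> n") auto
  qed (use assms(2) in simp)
  with NG_le[OF _ assms(2)] show ?thesis by simp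
qed

lemma NG_set_eq_Suc:
  assumes "mat 1 \<in> G" "S \<subseteq> gpow G (Suc n)" "x \<in> S" "x \<notin> gpow G n"
  shows "NG_set G S = Suc n"
  unfolding NG_set_def
proof (rule antisym)
  show "(SUP y\<in>S. enat (NG G y)) \<le> Suc n"
    using NG_le assms(2) by (intro SUP_least) auto
  show "enat (Suc n) \<le> (SUP y\<in>S. enat (NG G y))"
    using SUP_upper[OF assms(3), of "\<lambda>y. enat (NG G y)"] NG_eq_Suc assms by auto
qed

definition stoch2 :: "real \<Rightarrow> real \<Rightarrow> real^2^2" where
  "stoch2 a b = vector [vector [a, b], vector [1 - a, 1 - b]]"

lemma stoch2_nth [simp]:
  "stoch2 a b $ 1 $ 1 = a" "stoch2 a b $ 1 $ 2 = b"
  "stoch2 a b $ 2 $ 1 = 1 - a" "stoch2 a b $ 2 $ 2 = 1 - b"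
  by (simp_all add: stoch2_def)

lemma stoch2_eq_iff: "stoch2 a b = stoch2 c d \<longleftrightarrow> a = c \<and> b = d"
  by (metis stoch2_nth(1,2))

lemma stoch2_mult: "stoch2 a b ** stoch2 c d = stoch2 (b + c * (a - b)) (b + d * (a - b))"
  by (simp add: vec_eq_iff forall_2 matrix_matrix_mult_def sum_2) (simp add: algebra_simps)

lemma mat_1_eq_stoch2: "mat 1 = stoch2 1 0"
  by (simp add: vec_eq_iff forall_2 mat_def)

lemma mem_s2_iff: "A \<in> s2 \<longleftrightarrow> (\<exists>a\<in>{0..1}. \<exists>b\<in>{0..1}. A = stoch2 a b)"
proof
  assume "A \<in> s2"
  then have nonneg: "\<forall>i j. 0 \<le> A $ i $ j" and col: "\<forall>j. A $ 1 $ j + A $ 2 $ j = 1"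
    by (auto simp: s2_def sum_2)
  have "A = stoch2 (A $ 1 $ 1) (A $ 1 $ 2)"
    using col by (simp add: vec_eq_iff forall_2)
  moreover have "A $ 1 $ 1 \<in> {0..1}" "A $ 1 $ 2 \<in> {0..1}"
    using nonneg col by (smt (verit) atLeastAtMost_iff)+
  ultimately show "\<exists>a\<in>{0..1}. \<exists>b\<in>{0..1}. A = stoch2 a b" by blast
qed (auto simp: s2_def sum_2 forall_2)

lemma stoch2_in_s2: "a \<in> {0..1} \<Longrightarrow> b \<in> {0..1} \<Longrightarrow> stoch2 a b \<in> s2"
  unfolding mem_s2_iff by blast

lemma s2_mult_closed:
  assumes "A \<in> s2" "B \<in> s2"
  shows "A ** B \<in> s2"
proof -
  obtain a b c d where ab: "a \<in> {0..1}" "b \<in> {0..1}" and cd: "c \<in> {0..1}" "d \<in> {0..1}"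
    and AB: "A = stoch2 a b" "B = stoch2 c d"
    using assms unfolding mem_s2_iff by metis
  have between: "b + t * (a - b) \<in> {0..1}" if "t \<in> {0..1}" for t
  proof -
    have "b + t * (a - b) = (1 - t) * b + t * a"
      by algebra
    moreover have "0 \<le> (1 - t) * b + t * a" "(1 - t) * b + t * a \<le> 1"
      using ab that by (auto intro!: convex_bound_le add_nonneg_nonneg mult_nonneg_nonneg)
    ultimately show ?thesis by simp
  qed
  show ?thesis
    unfolding AB stoch2_mult using between[OF cd(1)] between[OF cd(2)] by (rule stoch2_in_s2)
qed

definition swap_segment :: "(real^2^2) set" where
  "swap_segment = insert (stoch2 0 1) ((\<lambda>t. stoch2 1 t) ` {0..1})"

lemma swap_segment_eq:
  "{vector [vector [0, 1], vector [1, 0]]}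
     \<union> convex hull {vector [vector [1, 0], vector [0, 1]], vector [vector [1, 1], vector [0, 0]]}
   = swap_segment"
proof -
  have "vector [vector [0, 1], vector [1, 0]] = stoch2 0 1"
    "vector [vector [1, 0], vector [0, 1]] = stoch2 1 0"
    "vector [vector [1, 1], vector [0, 0]] = stoch2 1 1"
    by (simp_all add: stoch2_def)
  moreover have "(1 - t) *\<^sub>R stoch2 1 0 + t *\<^sub>R stoch2 1 1 = stoch2 1 t" for t
    by (simp add: vec_eq_iff forall_2)
  ultimately show ?thesis
    unfolding swap_segment_def segment_convex_hull[symmetric] closed_segment_def
    by auto
qed

lemma mat_1_in_swap_segment: "mat 1 \<in> swap_segment"
  by (simp add: swap_segment_def mat_1_eq_stoch2)

lemma gpow_swap_segment_subset_s2: "gpow swap_segment k \<subseteq> s2"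
proof (rule gpow_subset_monoid)
  show "swap_segment \<subseteq> s2" "mat 1 \<in> s2"
    by (auto simp: swap_segment_def mat_1_eq_stoch2 intro!: stoch2_in_s2)
qed (rule s2_mult_closed)

lemma s2_subset_gpow4_swap_segment: "s2 \<subseteq> gpow swap_segment 4"
proof
  fix A assume "A \<in> s2"
  then obtain a b where ab: "a \<in> {0..1}" "b \<in> {0..1}" and A: "A = stoch2 a b"
    unfolding mem_s2_iff by blast
  have gens: "stoch2 0 1 \<in> swap_segment" "\<And>t. t \<in> {0..1} \<Longrightarrow> stoch2 1 t \<in> swap_segment"
    by (auto simp: swap_segment_def)
  have prod4: "p ** (q ** (r ** s)) \<in> gpow swap_segment 4"
    if "p \<in> swap_segment" "q \<in> swap_segment" "r \<in> swap_segment" "s \<in> swap_segment" for p q r s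
    using foldr_in_gpow[of "[p, q, r, s]" swap_segment] that by (simp add: numeral_eq_Suc)
  consider "a < b" | "b \<le> a" "b < 1" | "a = 1" "b = 1"
    using ab by force
  then show "A \<in> gpow swap_segment 4"
  proof cases
    case 1
    define s where "s = (1 - b) / (1 - a)"
    have "s \<in> {0..1}" "1 - s * (1 - a) = b"
      using 1 ab by (auto simp: s_def field_simps)
    then show ?thesis
      using prod4[OF gens(2) gens(1) gens(2) gens(2), of a s 0] ab
      by (simp add: A stoch2_mult algebra_simps)
  next
    case 2
    define u where "u = (a - b) / (1 - b)"
    have "1 - u \<in> {0..1}" "b + u * (1 - b) = a"
      using 2 ab by (auto simp: u_def field_simps)
    then show ?thesis
      using prod4[OF gens(2) gens(1) gens(2) gens(1), of b "1 - u"] ab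
      by (simp add: A stoch2_mult algebra_simps)
  next
    case 3
    then show ?thesis
      using prod4[OF gens(2) gens(2) gens(2) gens(2), of 1 0 0 0]
      by (simp add: A stoch2_mult)
  qed
qed

lemma stoch2_not_in_gpow3_swap_segment: "stoch2 (3/4) (1/4) \<notin> gpow swap_segment 3"
proof
  assume "stoch2 (3/4) (1/4) \<in> gpow swap_segment 3"
  then obtain p q r where pqr: "p \<in> swap_segment" "q \<in> swap_segment" "r \<in> swap_segment"
    and eq: "stoch2 (3/4) (1/4) = p ** (q ** r)"
    unfolding gpow_def by (auto simp: numeral_3_eq_3 length_Suc_conv)
  show False
    using pqr eq unfolding swap_segment_def
    by (auto simp: stoch2_mult stoch2_eq_iff) (smt (verit, best) mult_nonneg_nonneg)
qed

theorem proposition2: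
  fixes G :: "(real^2^2) set"
  assumes "G = {vector [vector [0, 1], vector [1, 0]]}
              \<union> convex hull {vector [vector [1, 0], vector [0, 1]], vector [vector [1, 1], vector [0, 0]]}"
  shows "gen_semigroup G = s2 \<and> NG_set G s2 = 4 \<and> gpow G 4 = s2 \<and> gpow G 3 \<subset> s2"
proof -
  have G: "G = swap_segment"
    using assms swap_segment_eq by simp
  have gpow4: "gpow G 4 = s2"
    using G gpow_swap_segment_subset_s2 s2_subset_gpow4_swap_segment by blast
  have witness: "stoch2 (3/4) (1/4) \<in> s2" "stoch2 (3/4) (1/4) \<notin> gpow G 3"
    using G stoch2_not_in_gpow3_swap_segment by (auto intro!: stoch2_in_s2)
  have "gen_semigroup G = s2"
    using gen_semigroup_eqI[OF _ gpow4] G gpow_swap_segment_subset_s2 by simp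
  moreover have "NG_set G s2 = 4"
    using NG_set_eq_Suc[of G s2 3] G mat_1_in_swap_segment gpow4 witness
    by (simp add: numeral_eq_enat)
  moreover have "gpow G 3 \<subset> s2"
    using G gpow_swap_segment_subset_s2 witness by blast
  ultimately show ?thesis
    using gpow4 by blast
qed

end
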